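(* Let $(X,Y)$ be a random vector in $\mathbb{R}^{d_x}\times\mathbb{R}^{d_y}$ with law $\nu$, $\mathbb{E}[\|X\|^2+\|Y\|^2]<\infty$ and $\mathbb{E}[X]=0$; let $\mu$ be a Borel probability measure on $\mathbb{R}^{d_y}$ with finite second moment, and let $\varepsilon>0$. Assume that $\mathbb{E}[XX^\top]$ is invertible and that for every $0<a<\infty$ the set $\{Q\in\tilde{\mathcal P}_1:\mathsf{KL}(Q\,\|\,\tilde R)\le a\}$ is compact for the $\tilde{\mathsf W}_1$-topology. For given $(f,g,h)\in L^1(\mu)\times L^1(\mu;\mathbb{R}^{d_x})\times L^1(\nu)$, they solve the dual problem (i.e. $D^\varepsilon(f,g,h)=\mathsf D^\varepsilon(\mu,\nu)$) if and only if they satisfy $$f(u)=-\varepsilon\log\int_{\mathbb{R}^{d_x+d_y}}e^{\frac1\varepsilon(\langle g(u),x\rangle+h(x,y)-c(u,y))}\,d\nu(x,y)\quad\mu\text{-a.e. }u,$$ $$\int_{\mathbb{R}^{d_x+d_y}}x\cdot e^{\frac1\varepsilon(\langle g(u),x\rangle+h(x,y)-c(u,y))}\,d\nu(x,y)=0\quad\mu\text{-a.e. }u,$$ $$h(x,y)=-\varepsilon\log\int_{\mathbb{R}^{d_y}}e^{\frac1\varepsilon(f(u)+\langle g(u),x\rangle-c(u,y))}\,d\mu(u)\quad\nu\text{-a.e. }(x,y).$$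
   Context: Points of $\mathbb{R}^{d_y}\times\mathbb{R}^{d_x+d_y}$ are written $(u,x,y)$; $c(u,y):=\frac12\|u-y\|^2$; $R:=\mu\otimes\nu$. $\mathsf{KL}(P\|Q)=\int\log\frac{dP}{dQ}\,dP$ if $P\ll Q$ and $\infty$ otherwise. Dual problem: $\mathsf D^\varepsilon(\mu,\nu):=\sup D^\varepsilon(f,g,h)$ over $(f,g,h)\in L^1(\mu)\times L^1(\mu;\mathbb{R}^{d_x})\times L^1(\nu)$, where $$D^\varepsilon(f,g,h):=\int f\,d\mu+\int h\,d\nu-\varepsilon\int e^{\frac1\varepsilon(f(u)+\langle g(u),x\rangle+h(x,y)-c(u,y))}\,dR(u,x,y)+\varepsilon\in[-\infty,\infty).$$ $\tilde R$ is the probability measure $d\tilde R:=\alpha^{-1}e^{-c/\varepsilon}\,dR$ with $\alpha:=\int e^{-c/\varepsilon}\,dR$. The metric $\tilde{\mathsf d}$ on $\mathbb{R}^{d_y}\times\mathbb{R}^{d_x+d_y}$ is $\tilde{\mathsf d}((u,x,y),(u',x',y')):=\min\{\|u-u'\|,1\}+\|x-x'\|+\min\{\|y-y'\|,1\}$; $\tilde{\mathcal P}_1$ is the set of Borel probability measures $P$ on this space with $\int\tilde{\mathsf d}(\cdot,0)\,dP<\infty$; $\tilde{\mathsf W}_1(P,Q):=\inf_{\gamma\in\Pi(P,Q)}\int\tilde{\mathsf d}\,d\gamma$ (infimum over couplings) is the corresponding $1$-Wasserstein metric on $\tilde{\mathcal P}_1$. *)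

theory Defs
  imports "HOL-Probability.Probability"
begin

text \<open>Points \<open>(u, x, y)\<close> with \<open>u, y\<close> in \<open>real ^ 'n\<close>, \<open>x\<close> in \<open>real ^ 'm\<close>, that is,
  \<open>d\<^sub>x = CARD('m)\<close> and \<open>d\<^sub>y = CARD('n)\<close>.\<close>

type_synonym ('m, 'n) pt = "(real ^ 'n) \<times> (real ^ 'm) \<times> (real ^ 'n)"

definition cost :: "real ^ 'n \<Rightarrow> real ^ 'n \<Rightarrow> real" where
  "cost u y = 1 / 2 * (norm (u - y))\<^sup>2"

definition ref_measure ::
    "(real ^ 'n) measure \<Rightarrow> ((real ^ 'm) \<times> (real ^ 'n)) measure \<Rightarrow> ('m, 'n) pt measure" where
  "ref_measure \<mu> \<nu> = \<mu> \<Otimes>\<^sub>M \<nu>"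

text \<open>The dual objective. The integral of the exponential is a nonnegative integral, so it may be
  infinite, in which case the value is \<open>-\<infinity>\<close>.\<close>

definition dual_obj ::
    "real \<Rightarrow> (real ^ 'n) measure \<Rightarrow> ((real ^ 'm) \<times> (real ^ 'n)) measure
      \<Rightarrow> (real ^ 'n \<Rightarrow> real) \<Rightarrow> (real ^ 'n \<Rightarrow> real ^ 'm) \<Rightarrow> ((real ^ 'm) \<times> (real ^ 'n) \<Rightarrow> real)
      \<Rightarrow> ereal" where
  "dual_obj \<epsilon> \<mu> \<nu> f g h =
     ereal ((LINT u|\<mu>. f u) + (LINT p|\<nu>. h p))
     - ereal \<epsilon> * enn2ereal (\<integral>\<^sup>+ (u, x, y).
         ennreal (exp (1 / \<epsilon> * (f u + g u \<bullet> x + h (x, y) - cost u y))) \<partial>ref_measure \<mu> \<nu>)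
     + ereal \<epsilon>"

definition dual_value ::
    "real \<Rightarrow> (real ^ 'n) measure \<Rightarrow> ((real ^ 'm) \<times> (real ^ 'n)) measure \<Rightarrow> ereal" where
  "dual_value \<epsilon> \<mu> \<nu> =
     (SUP (f, g, h) \<in> {(f, g, h). integrable \<mu> f \<and> integrable \<mu> g \<and> integrable \<nu> h}.
        dual_obj \<epsilon> \<mu> \<nu> f g h)"

definition ref_tilde ::
    "real \<Rightarrow> (real ^ 'n) measure \<Rightarrow> ((real ^ 'm) \<times> (real ^ 'n)) measure \<Rightarrow> ('m, 'n) pt measure" where
  "ref_tilde \<epsilon> \<mu> \<nu> =
     (let \<alpha> = LINT (u, x, y)|ref_measure \<mu> \<nu>. exp (- cost u y / \<epsilon>)
      in density (ref_measure \<mu> \<nu>) (\<lambda>(u, x, y). ennreal (inverse \<alpha> * exp (- cost u y / \<epsilon>))))"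

text \<open>Relative entropy \<open>KL(P \<parallel> Q)\<close>. The library's \<^const>\<open>KL_divergence\<close> is real-valued, has the
  reference measure as its first measure argument, and is \<open>0\<close> if the log-density is not integrable.
  For probability measures with \<open>P \<lless> Q\<close> the negative part of \<open>log (dP/dQ)\<close> is always
  \<open>P\<close>-integrable, so non-integrability means that the integral is \<open>\<infinity>\<close>.\<close>

definition KL :: "'a measure \<Rightarrow> 'a measure \<Rightarrow> ereal" where
  "KL P Q =
     (if absolutely_continuous Q P \<and> integrable P (entropy_density (exp 1) Q P)
      then ereal (KL_divergence (exp 1) Q P) else \<infinity>)"

definition dtilde :: "('m::finite, 'n::finite) pt \<Rightarrow> ('m, 'n) pt \<Rightarrow> real" where
  "dtilde = (\<lambda>(u, x, y) (u', x', y').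
     min (norm (u - u')) 1 + norm (x - x') + min (norm (y - y')) 1)"

definition P1tilde :: "('m::finite, 'n::finite) pt measure set" where
  "P1tilde = {P. prob_space P \<and> sets P = sets borel \<and> (\<integral>\<^sup>+ z. ennreal (dtilde z 0) \<partial>P) < \<infinity>}"

definition couplings ::
    "'a::topological_space measure \<Rightarrow> 'a measure \<Rightarrow> ('a \<times> 'a) measure set" where
  "couplings P Q =
     {\<gamma>. prob_space \<gamma> \<and> sets \<gamma> = sets (borel \<Otimes>\<^sub>M borel)
        \<and> distr \<gamma> borel fst = P \<and> distr \<gamma> borel snd = Q}"

text \<open>On \<^const>\<open>P1tilde\<close> the infimum is finite, so \<^const>\<open>enn2real\<close> loses no information there.\<close>

definition W1tilde :: "('m::finite, 'n::finite) pt measure \<Rightarrow> ('m, 'n) pt measure \<Rightarrow> real" where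
  "W1tilde P Q =
     enn2real (INF \<gamma> \<in> couplings P Q. \<integral>\<^sup>+ (z, z'). ennreal (dtilde z z') \<partial>\<gamma>)"

abbreviation W1tilde_topology :: "('m::finite, 'n::finite) pt measure topology" where
  "W1tilde_topology \<equiv> Metric_space.mtopology P1tilde W1tilde"

text \<open>Natural logarithm on \<open>[0, \<infinity>]\<close>: an identity \<open>a = - \<epsilon> log (\<integral> \<dots>)\<close> with \<open>a\<close> real then
  includes the claim that the integral is finite and positive.\<close>

definition ln_ext :: "ennreal \<Rightarrow> ereal" where
  "ln_ext t = (if t = 0 then - \<infinity> else if t = \<infinity> then \<infinity> else ereal (ln (enn2real t)))"

end

theory Submission
  imports Defs
begin

text \<open>Write \<open>E = exp ((f(u) + \<langle>g(u), x\<rangle> + h(x, y) - c(u, y)) / \<epsilon>)\<close> for the Gibbs density of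
  \<open>(f, g, h)\<close> with respect to \<open>R = \<mu> \<otimes> \<nu>\<close>. The three equations say that \<open>E dR\<close> has first marginal \<open>\<mu>\<close>,
  has second marginal \<open>\<nu>\<close>, and gives \<open>x\<close> conditional mean zero given \<open>u\<close>. The dual objective is
  concave, and these are its first-order conditions.

  Sufficiency. For a competitor with Gibbs density \<open>E'\<close> and exponents differing by \<open>s / \<epsilon>\<close>,
  convexity of \<open>exp\<close> gives \<open>\<epsilon> (E' - E) \<ge> s E\<close>; integrating, the marginal conditions turn
  the contributions of \<open>f' - f\<close> and \<open>h' - h\<close> into integrals against \<open>\<mu>\<close> and \<open>\<nu>\<close>. The mixed term
  \<open>\<langle>g'(u) - g(u), x\<rangle> E\<close> has vanishing fibre integrals, but its \<open>R\<close>-integrability is not given. It is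
  however bounded above by an \<open>R\<close>-integrable function, which together with vanishing fibre integrals
  is enough (\<open>integrable_of_upper_bound_of_fibres\<close>).

  Necessity. If \<open>E'\<close> arises from an optimal triple by a perturbation that is bounded above, then
  dominated convergence gives a one-sided first-order condition (\<open>first_variation\<close>). Indicator
  perturbations of \<open>f\<close> and of \<open>h\<close>, with both signs, give the marginal conditions. A perturbation of
  \<open>g\<close> alone is unbounded, and could make the integral of \<open>E\<close> infinite; it is therefore
  accompanied by the perturbation \<open>- norm x\<close> of \<open>h\<close>, which makes the total nonpositive and whose
  effect to first order cancels, since the second marginal is already known to be \<open>\<nu>\<close>.\<close>

section \<open>Two auxiliary facts\<close>

text \<open>A one-sided variant of Fubini's theorem: an integrable upper bound replaces the integrability
  of \<open>w\<close>. The integral of \<open>G - w \<ge> 0\<close> over almost every fibre equals that of \<open>G\<close>, so \<open>G - w\<close> is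
  integrable by Tonelli's theorem.\<close>

lemma (in pair_sigma_finite) integrable_of_upper_bound_of_fibres:
  fixes w G :: "'a \<times> 'b \<Rightarrow> real"
  assumes w [measurable]: "w \<in> borel_measurable (M1 \<Otimes>\<^sub>M M2)"
    and G: "integrable (M1 \<Otimes>\<^sub>M M2) G"
    and le: "\<And>z. w z \<le> G z"
    and fibre: "AE u in M1. integrable M2 (\<lambda>p. w (u, p)) \<and> (LINT p|M2. w (u, p)) = 0"
  shows "integrable (M1 \<Otimes>\<^sub>M M2) w" and "integral\<^sup>L (M1 \<Otimes>\<^sub>M M2) w = 0"
proof -
  have Gm [measurable]: "G \<in> borel_measurable (M1 \<Otimes>\<^sub>M M2)"
    using G by (rule borel_measurable_integrable)
  have "AE u in M1. (\<integral>\<^sup>+ p. ennreal (G (u, p) - w (u, p)) \<partial>M2) = ennreal (LINT p|M2. G (u, p))"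
    using fibre AE_integrable_fst'[OF G]
  proof eventually_elim
    case (elim u)
    then have "integrable M2 (\<lambda>p. G (u, p) - w (u, p))" by simp
    then have "(\<integral>\<^sup>+ p. ennreal (G (u, p) - w (u, p)) \<partial>M2)
        = ennreal (LINT p|M2. G (u, p) - w (u, p))"
      using le by (intro nn_integral_eq_integral) auto
    with elim show ?case by simp
  qed
  then have "(\<integral>\<^sup>+ z. ennreal (G z - w z) \<partial>(M1 \<Otimes>\<^sub>M M2)) = (\<integral>\<^sup>+ u. ennreal (LINT p|M2. G (u, p)) \<partial>M1)"
    by (subst M2.nn_integral_fst[symmetric]) (auto intro!: nn_integral_cong_AE)
  also have "\<dots> < \<infinity>"
  proof -
    have "integrable M1 (\<lambda>u. LINT p|M2. G (u, p))" using G by (rule integrable_fst')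
    then have "(\<integral>\<^sup>+ u. ennreal (norm (LINT p|M2. G (u, p))) \<partial>M1) < \<infinity>"
      by (simp add: integrable_iff_bounded)
    moreover have "(\<integral>\<^sup>+ u. ennreal (LINT p|M2. G (u, p)) \<partial>M1)
        \<le> (\<integral>\<^sup>+ u. ennreal (norm (LINT p|M2. G (u, p))) \<partial>M1)"
      by (intro nn_integral_mono ennreal_leI) simp
    ultimately show ?thesis by (rule le_less_trans[rotated])
  qed
  finally have "(\<integral>\<^sup>+ z. ennreal (norm (G z - w z)) \<partial>(M1 \<Otimes>\<^sub>M M2)) < \<infinity>"
    using le by simp
  then have "integrable (M1 \<Otimes>\<^sub>M M2) (\<lambda>z. G z - w z)"
    by (intro integrableI_bounded) auto
  from Bochner_Integration.integrable_diff[OF G this]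
  have "integrable (M1 \<Otimes>\<^sub>M M2) (\<lambda>z. G z - (G z - w z))" .
  moreover have "(\<lambda>z. G z - (G z - w z)) = w" by auto
  ultimately show I: "integrable (M1 \<Otimes>\<^sub>M M2) w" by (simp only:)
  have "integral\<^sup>L (M1 \<Otimes>\<^sub>M M2) w = (LINT u|M1. LINT p|M2. w (u, p))"
    using integral_fst'[OF I] by simp
  also have "\<dots> = (LINT u|M1. 0)"
    using fibre integrable_fst'[OF I] by (intro integral_cong_AE) auto
  finally show "integral\<^sup>L (M1 \<Otimes>\<^sub>M M2) w = 0" by simp
qed

text \<open>The degenerate values \<open>t = 0\<close> and \<open>t = \<infinity>\<close> fail both sides.\<close>

lemma potential_eq_iff:
  fixes a \<epsilon> :: real
  assumes "\<epsilon> > 0"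
  shows "ereal a = - ereal \<epsilon> * ln_ext t \<longleftrightarrow> ennreal (exp (a / \<epsilon>)) * t = 1"
proof (cases t)
  case (real r)
  show ?thesis
  proof (cases "r = 0")
    case False
    with real have r: "r > 0" by simp
    have "ereal a = - ereal \<epsilon> * ln_ext t \<longleftrightarrow> a = - \<epsilon> * ln r"
      using real r by (simp add: ln_ext_def)
    also have "\<dots> \<longleftrightarrow> a / \<epsilon> + ln r = 0"
      using assms by (auto simp: field_simps)
    also have "\<dots> \<longleftrightarrow> exp (a / \<epsilon>) * r = 1"
      using r by (metis exp_add exp_ln exp_eq_one_iff)
    also have "\<dots> \<longleftrightarrow> ennreal (exp (a / \<epsilon>)) * t = 1"
      using real r by (simp flip: ennreal_mult' add: ennreal_eq_1)
    finally show ?thesis .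
  qed (use real assms in \<open>simp add: ln_ext_def\<close>)
next
  case top
  then show ?thesis using assms by (simp add: ln_ext_def ennreal_mult_top)
qed

section \<open>The entropic dual problem over a product of probability spaces\<close>

text \<open>The setting keeps only what the argument uses: a point \<open>p\<close> of the second space stands for
  \<open>(x, y)\<close>, an integrable map \<open>T\<close> for the projection to \<open>x\<close>, and \<open>c\<close> is any nonnegative measurable
  cost.\<close>

locale entropic_dual = pair_prob_space M N
  for M :: "'a measure" and N :: "'b measure" +
  fixes T :: "'b \<Rightarrow> 'v::euclidean_space" and c :: "'a \<Rightarrow> 'b \<Rightarrow> real" and \<epsilon> :: real
  assumes T_integrable: "integrable N T"
    and c_measurable [measurable]: "case_prod c \<in> borel_measurable (M \<Otimes>\<^sub>M N)"
    and c_nonneg: "c u p \<ge> 0"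
    and eps_pos: "\<epsilon> > 0"
begin

lemma T_measurable [measurable]: "T \<in> borel_measurable N"
  using T_integrable by (rule borel_measurable_integrable)

text \<open>The domain \<open>L\<^sup>1(M) \<times> L\<^sup>1(M; 'v) \<times> L\<^sup>1(N)\<close> of the dual objective.\<close>

definition admissible :: "('a \<Rightarrow> real) \<Rightarrow> ('a \<Rightarrow> 'v) \<Rightarrow> ('b \<Rightarrow> real) \<Rightarrow> bool" where
  "admissible f g h \<longleftrightarrow> integrable M f \<and> integrable M g \<and> integrable N h"

text \<open>The density, with respect to the product measure, attached to a triple of potentials.\<close>

definition gibbs :: "('a \<Rightarrow> real) \<Rightarrow> ('a \<Rightarrow> 'v) \<Rightarrow> ('b \<Rightarrow> real) \<Rightarrow> 'a \<times> 'b \<Rightarrow> real" where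
  "gibbs f g h = (\<lambda>(u, p). exp ((f u + g u \<bullet> T p + h p - c u p) / \<epsilon>))"

text \<open>The dual objective, equal to \<open>- \<infinity>\<close> if the Gibbs density is not integrable.\<close>

definition objective :: "('a \<Rightarrow> real) \<Rightarrow> ('a \<Rightarrow> 'v) \<Rightarrow> ('b \<Rightarrow> real) \<Rightarrow> ereal" where
  "objective f g h = ereal ((LINT u|M. f u) + (LINT p|N. h p))
     - ereal \<epsilon> * enn2ereal (\<integral>\<^sup>+ z. ennreal (gibbs f g h z) \<partial>(M \<Otimes>\<^sub>M N)) + ereal \<epsilon>"

text \<open>The real value of the dual objective, meaningful only if the Gibbs density is integrable
  (otherwise the Lebesgue integral is \<open>0\<close> by convention).\<close>

definition finite_objective :: "('a \<Rightarrow> real) \<Rightarrow> ('a \<Rightarrow> 'v) \<Rightarrow> ('b \<Rightarrow> real) \<Rightarrow> real" where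
  "finite_objective f g h = (LINT u|M. f u) + (LINT p|N. h p)
     - \<epsilon> * (LINT z|(M \<Otimes>\<^sub>M N). gibbs f g h z) + \<epsilon>"

lemma gibbs_pos: "gibbs f g h z > 0" and gibbs_nonneg: "gibbs f g h z \<ge> 0"
  by (auto simp: gibbs_def split: prod.split)

lemma admissible_measurable:
  assumes "admissible f g h"
  shows "f \<in> borel_measurable M" "g \<in> borel_measurable M" "h \<in> borel_measurable N"
  using assms by (auto simp: admissible_def)

lemma gibbs_measurable:
  assumes "admissible f g h"
  shows "gibbs f g h \<in> borel_measurable (M \<Otimes>\<^sub>M N)"
  using admissible_measurable[OF assms, measurable] unfolding gibbs_def by measurable

lemma objective_eq:
  assumes "admissible f g h"
  shows "objective f g h = (if integrable (M \<Otimes>\<^sub>M N) (gibbs f g h)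
           then ereal (finite_objective f g h) else - \<infinity>)"
proof (cases "integrable (M \<Otimes>\<^sub>M N) (gibbs f g h)")
  case True
  then have "(\<integral>\<^sup>+ z. ennreal (gibbs f g h z) \<partial>(M \<Otimes>\<^sub>M N))
      = ennreal (LINT z|(M \<Otimes>\<^sub>M N). gibbs f g h z)"
    by (intro nn_integral_eq_integral) (auto simp: gibbs_nonneg)
  then show ?thesis
    using True by (simp add: objective_def finite_objective_def enn2ereal_ennreal
        integral_nonneg_AE gibbs_nonneg)
next
  case False
  then have "\<not> (\<integral>\<^sup>+ z. ennreal (gibbs f g h z) \<partial>(M \<Otimes>\<^sub>M N)) < \<infinity>"
    using integrableI_nonneg[OF gibbs_measurable[OF assms]] by (auto simp: gibbs_nonneg)
  then have "(\<integral>\<^sup>+ z. ennreal (gibbs f g h z) \<partial>(M \<Otimes>\<^sub>M N)) = \<infinity>"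
    by (simp add: less_top[symmetric])
  then show ?thesis using False eps_pos by (simp add: objective_def)
qed

text \<open>The zero triple has a finite objective, so the dual value is not \<open>- \<infinity>\<close>; this is
  where nonnegativity of the cost enters.\<close>

lemma integrable_gibbs_0: "integrable (M \<Otimes>\<^sub>M N) (gibbs (\<lambda>_. 0) (\<lambda>_. 0) (\<lambda>_. 0))"
proof (rule P.integrable_const_bound[where B = 1])
  show "AE z in M \<Otimes>\<^sub>M N. norm (gibbs (\<lambda>_. 0) (\<lambda>_. 0) (\<lambda>_. 0) z) \<le> 1"
    using c_nonneg eps_pos by (auto simp: gibbs_def divide_simps split: prod.split)
  show "gibbs (\<lambda>_. 0) (\<lambda>_. 0) (\<lambda>_. 0) \<in> borel_measurable (M \<Otimes>\<^sub>M N)"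
    by (rule gibbs_measurable) (simp add: admissible_def)
qed

text \<open>Optimality in terms of real values: competitors with a non-integrable Gibbs density have
  objective \<open>- \<infinity>\<close> and can be left out.\<close>

definition optimal :: "('a \<Rightarrow> real) \<Rightarrow> ('a \<Rightarrow> 'v) \<Rightarrow> ('b \<Rightarrow> real) \<Rightarrow> bool" where
  "optimal f g h \<longleftrightarrow> integrable (M \<Otimes>\<^sub>M N) (gibbs f g h) \<and>
     (\<forall>f' g' h'. admissible f' g' h' \<longrightarrow> integrable (M \<Otimes>\<^sub>M N) (gibbs f' g' h') \<longrightarrow>
        finite_objective f' g' h' \<le> finite_objective f g h)"

lemma objective_eq_SUP_iff:
  assumes adm: "admissible f g h"
  shows "objective f g h = (SUP (f', g', h') \<in> {(f', g', h'). admissible f' g' h'}. objective f' g' h')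
    \<longleftrightarrow> optimal f g h" (is "_ = ?S \<longleftrightarrow> _")
proof
  have le: "objective f' g' h' \<le> ?S" if "admissible f' g' h'" for f' g' h'
    using that by (intro SUP_upper2[where i = "(f', g', h')"]) auto
  assume eq: "objective f g h = ?S"
  have adm0: "admissible (\<lambda>_. 0) (\<lambda>_. 0) (\<lambda>_. 0)" by (simp add: admissible_def)
  then have "objective f g h \<noteq> - \<infinity>"
    using le[OF adm0] by (auto simp: eq objective_eq[OF adm0] integrable_gibbs_0)
  then have I: "integrable (M \<Otimes>\<^sub>M N) (gibbs f g h)"
    using objective_eq[OF adm] by (auto split: if_splits)
  show "optimal f g h"
    unfolding optimal_def
  proof (intro conjI allI impI I)
    fix f' g' h' assume *: "admissible f' g' h'" "integrable (M \<Otimes>\<^sub>M N) (gibbs f' g' h')"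
    show "finite_objective f' g' h' \<le> finite_objective f g h"
      using le[OF *(1)] I * by (simp flip: eq add: objective_eq adm)
  qed
next
  assume opt: "optimal f g h"
  show "objective f g h = ?S"
  proof (rule antisym)
    show "objective f g h \<le> ?S"
      using adm by (intro SUP_upper2[where i = "(f, g, h)"]) auto
    show "?S \<le> objective f g h"
      using opt adm by (intro SUP_least) (auto simp: objective_eq optimal_def)
  qed
qed

lemma gibbs_add:
  "gibbs (\<lambda>u. f u + \<phi> u) (\<lambda>u. g u + \<gamma> u) (\<lambda>p. h p + \<eta> p) (u, p)
    = gibbs f g h (u, p) * exp ((\<phi> u + \<gamma> u \<bullet> T p + \<eta> p) / \<epsilon>)"
  by (simp add: gibbs_def inner_add_left add_divide_distrib diff_divide_distrib flip: exp_add)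

section \<open>First variation\<close>

text \<open>The one-sided derivative of the objective in direction \<open>(\<phi>, \<gamma>, \<eta>)\<close> at a maximiser is
  nonpositive. The upper bound \<open>B\<close> keeps the perturbed Gibbs densities integrable for
  positive step sizes.\<close>

lemma first_variation:
  assumes adm: "admissible f g h" and opt: "optimal f g h" and adm': "admissible \<phi> \<gamma> \<eta>"
    and bound: "\<And>u p. \<phi> u + \<gamma> u \<bullet> T p + \<eta> p \<le> B"
    and int: "integrable (M \<Otimes>\<^sub>M N) (\<lambda>(u, p). (\<phi> u + \<gamma> u \<bullet> T p + \<eta> p) * gibbs f g h (u, p))"
  shows "(LINT u|M. \<phi> u) + (LINT p|N. \<eta> p)
    \<le> (LINT (u, p)|(M \<Otimes>\<^sub>M N). (\<phi> u + \<gamma> u \<bullet> T p + \<eta> p) * gibbs f g h (u, p))"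
proof -
  define \<psi> where "\<psi> = (\<lambda>(u, p). \<phi> u + \<gamma> u \<bullet> T p + \<eta> p)"
  define C where "C = exp (max B 0 / \<epsilon>)"
  note [measurable] = gibbs_measurable[OF adm] admissible_measurable[OF adm']
  have \<psi>m [measurable]: "\<psi> \<in> borel_measurable (M \<Otimes>\<^sub>M N)"
    unfolding \<psi>_def by measurable
  have int\<psi>: "integrable (M \<Otimes>\<^sub>M N) (\<lambda>z. \<psi> z * gibbs f g h z)"
    using int by (simp add: \<psi>_def case_prod_unfold)
  have I: "integrable (M \<Otimes>\<^sub>M N) (gibbs f g h)" using opt by (simp add: optimal_def)
  have exp_le: "exp (t * \<psi> z / \<epsilon>) \<le> C" if "0 \<le> t" "t \<le> 1" for t z
  proof -
    have "t * \<psi> z \<le> t * max B 0"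
      using bound that by (intro mult_left_mono) (auto simp: \<psi>_def split: prod.split intro: max.coboundedI1)
    also have "\<dots> \<le> max B 0" using that by (intro mult_left_le_one_le) auto
    finally show ?thesis using eps_pos by (simp add: C_def divide_right_mono)
  qed
  let ?t = "\<lambda>n. 1 / real (Suc n)"
  let ?e = "\<lambda>n z. exp (?t n * \<psi> z / \<epsilon>)"
  have key: "(LINT u|M. \<phi> u) + (LINT p|N. \<eta> p)
      \<le> (LINT z|(M \<Otimes>\<^sub>M N). \<psi> z * gibbs f g h z * ?e n z)" for n
  proof -
    let ?f = "\<lambda>u. f u + ?t n * \<phi> u" and ?g = "\<lambda>u. g u + ?t n *\<^sub>R \<gamma> u"
      and ?h = "\<lambda>p. h p + ?t n * \<eta> p"
    have t: "0 < ?t n" "?t n \<le> 1" by auto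
    have E: "gibbs ?f ?g ?h = (\<lambda>z. gibbs f g h z * ?e n z)"
    proof
      fix z show "gibbs ?f ?g ?h z = gibbs f g h z * ?e n z"
        by (cases z) (simp add: gibbs_add \<psi>_def distrib_left)
    qed
    have adm_n: "admissible ?f ?g ?h" using adm adm' by (simp add: admissible_def)
    have I_n: "integrable (M \<Otimes>\<^sub>M N) (\<lambda>z. gibbs f g h z * ?e n z)"
    proof (rule Bochner_Integration.integrable_bound)
      show "integrable (M \<Otimes>\<^sub>M N) (\<lambda>z. gibbs f g h z * C)" using I by simp
      show "AE z in M \<Otimes>\<^sub>M N. norm (gibbs f g h z * ?e n z) \<le> norm (gibbs f g h z * C)"
        using exp_le[of "?t n"] t gibbs_nonneg[of f g h]
        by (intro AE_I2) (auto simp: abs_mult C_def intro!: mult_left_mono)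
    qed measurable
    have I'_n: "integrable (M \<Otimes>\<^sub>M N) (\<lambda>z. \<psi> z * gibbs f g h z * ?e n z)"
    proof (rule Bochner_Integration.integrable_bound)
      show "integrable (M \<Otimes>\<^sub>M N) (\<lambda>z. \<psi> z * gibbs f g h z * C)" using int\<psi> by simp
      show "AE z in M \<Otimes>\<^sub>M N. norm (\<psi> z * gibbs f g h z * ?e n z) \<le> norm (\<psi> z * gibbs f g h z * C)"
        using exp_le[of "?t n"] t
        by (intro AE_I2) (auto simp: abs_mult C_def intro!: mult_left_mono)
    qed measurable
    have "finite_objective ?f ?g ?h \<le> finite_objective f g h"
      using opt adm_n I_n unfolding E[symmetric] optimal_def by blast
    then have "?t n * ((LINT u|M. \<phi> u) + (LINT p|N. \<eta> p))
        \<le> \<epsilon> * (LINT z|(M \<Otimes>\<^sub>M N). gibbs f g h z * ?e n z) - \<epsilon> * (LINT z|(M \<Otimes>\<^sub>M N). gibbs f g h z)"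
      using adm adm' unfolding finite_objective_def E admissible_def
      by (simp add: distrib_left add_divide_distrib)
    also have "\<dots> = (LINT z|(M \<Otimes>\<^sub>M N). \<epsilon> * (gibbs f g h z * ?e n z - gibbs f g h z))"
      using I I_n by (simp add: right_diff_distrib)
    \<comment> \<open>Pointwise, \<open>exp s - 1 \<le> s * exp s\<close>: the difference quotient is bounded by the derivative
        at the perturbed point.\<close>
    also have "\<dots> \<le> (LINT z|(M \<Otimes>\<^sub>M N). ?t n * (\<psi> z * gibbs f g h z * ?e n z))"
    proof (rule integral_mono)
      fix z
      define s where "s = ?t n * \<psi> z / \<epsilon>"
      have "1 - s \<le> exp (- s)" using exp_ge_add_one_self[of "- s"] by simp
      then have "exp s * (1 - s) \<le> 1" by (simp add: exp_minus field_simps)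
      then have "exp s - 1 \<le> s * exp s" by (simp add: algebra_simps)
      then have "\<epsilon> * gibbs f g h z * (exp s - 1) \<le> \<epsilon> * gibbs f g h z * (s * exp s)"
        using eps_pos gibbs_nonneg[of f g h z] by (intro mult_left_mono) auto
      moreover have "\<epsilon> * s = ?t n * \<psi> z" using eps_pos by (simp add: s_def)
      then have "\<epsilon> * gibbs f g h z * (s * exp s) = ?t n * (\<psi> z * gibbs f g h z * exp s)"
        by (metis (no_types, opaque_lifting) mult.assoc mult.commute)
      ultimately show "\<epsilon> * (gibbs f g h z * ?e n z - gibbs f g h z)
          \<le> ?t n * (\<psi> z * gibbs f g h z * ?e n z)"
        by (simp add: s_def algebra_simps)
    qed (use I I_n I'_n in \<open>auto intro!: integrable_mult_right\<close>)
    also have "\<dots> = ?t n * (LINT z|(M \<Otimes>\<^sub>M N). \<psi> z * gibbs f g h z * ?e n z)"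
      by (rule integral_mult_right_zero)
    finally show ?thesis using t(1) by (simp only: mult_le_cancel_left_pos)
  qed
  have lim: "(\<lambda>n. LINT z|(M \<Otimes>\<^sub>M N). \<psi> z * gibbs f g h z * ?e n z)
      \<longlonglongrightarrow> (LINT z|(M \<Otimes>\<^sub>M N). \<psi> z * gibbs f g h z)"
  proof (rule integral_dominated_convergence[where w = "\<lambda>z. C * \<bar>\<psi> z * gibbs f g h z\<bar>"])
    show "integrable (M \<Otimes>\<^sub>M N) (\<lambda>z. C * \<bar>\<psi> z * gibbs f g h z\<bar>)"
      using int\<psi> by (intro integrable_mult_right integrable_abs)
    show "AE z in M \<Otimes>\<^sub>M N. (\<lambda>n. \<psi> z * gibbs f g h z * ?e n z) \<longlonglongrightarrow> \<psi> z * gibbs f g h z"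
    proof (rule AE_I2)
      fix z
      have "(\<lambda>n. ?e n z) \<longlonglongrightarrow> exp (0 * \<psi> z / \<epsilon>)"
        using LIMSEQ_inverse_real_of_nat eps_pos
        by (intro tendsto_intros) (auto simp: inverse_eq_divide)
      from tendsto_mult_left[OF this, of "\<psi> z * gibbs f g h z"]
      show "(\<lambda>n. \<psi> z * gibbs f g h z * ?e n z) \<longlonglongrightarrow> \<psi> z * gibbs f g h z" by simp
    qed
    show "AE z in M \<Otimes>\<^sub>M N. norm (\<psi> z * gibbs f g h z * ?e n z) \<le> C * \<bar>\<psi> z * gibbs f g h z\<bar>" for n
      using exp_le[of "?t n"]
      by (intro AE_I2) (auto simp: abs_mult mult.commute[of C] intro!: mult_left_mono)
  qed measurable
  have "(LINT u|M. \<phi> u) + (LINT p|N. \<eta> p) \<le> (LINT z|(M \<Otimes>\<^sub>M N). \<psi> z * gibbs f g h z)"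
    by (rule LIMSEQ_le_const[OF lim]) (use key in blast)
  then show ?thesis by (simp add: \<psi>_def case_prod_unfold)
qed

section \<open>The optimality system\<close>

text \<open>The measure with density \<^const>\<open>gibbs\<close> has first marginal \<open>M\<close>, expressed through the fibre
  integrals of the density.\<close>

definition fst_marginal :: "('a \<Rightarrow> real) \<Rightarrow> ('a \<Rightarrow> 'v) \<Rightarrow> ('b \<Rightarrow> real) \<Rightarrow> bool" where
  "fst_marginal f g h \<longleftrightarrow> (AE u in M. (\<integral>\<^sup>+ p. ennreal (gibbs f g h (u, p)) \<partial>N) = 1)"

text \<open>The same for the second marginal \<open>N\<close>.\<close>

definition snd_marginal :: "('a \<Rightarrow> real) \<Rightarrow> ('a \<Rightarrow> 'v) \<Rightarrow> ('b \<Rightarrow> real) \<Rightarrow> bool" where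
  "snd_marginal f g h \<longleftrightarrow> (AE p in N. (\<integral>\<^sup>+ u. ennreal (gibbs f g h (u, p)) \<partial>M) = 1)"

text \<open>Under the measure with density \<^const>\<open>gibbs\<close>, the barycentre of \<open>T\<close> on almost every fibre
  over the first space exists and is zero. Integrability is stated separately because the Lebesgue
  integral of a non-integrable function is \<open>0\<close> by convention.\<close>

definition fibre_barycentre_0 :: "('a \<Rightarrow> real) \<Rightarrow> ('a \<Rightarrow> 'v) \<Rightarrow> ('b \<Rightarrow> real) \<Rightarrow> bool" where
  "fibre_barycentre_0 f g h \<longleftrightarrow> (AE u in M. integrable N (\<lambda>p. gibbs f g h (u, p) *\<^sub>R T p) \<and>
     (LINT p|N. gibbs f g h (u, p) *\<^sub>R T p) = 0)"

lemma fst_marginal_integral: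
  fixes k :: "'a \<Rightarrow> real"
  assumes adm: "admissible f g h" and marg: "fst_marginal f g h" and k: "integrable M k"
  shows "integrable (M \<Otimes>\<^sub>M N) (\<lambda>(u, p). k u * gibbs f g h (u, p))"
    and "(LINT (u, p)|(M \<Otimes>\<^sub>M N). k u * gibbs f g h (u, p)) = (LINT u|M. k u)"
proof -
  let ?P = "density (M \<Otimes>\<^sub>M N) (\<lambda>z. ennreal (gibbs f g h z))"
  note [measurable] = gibbs_measurable[OF adm] borel_measurable_integrable[OF k]
  have D: "distr ?P M fst = M"
  proof (rule measure_eqI)
    fix A assume "A \<in> sets (distr ?P M fst)"
    then have A [measurable]: "A \<in> sets M" by simp
    have "emeasure (distr ?P M fst) A
        = (\<integral>\<^sup>+ z. ennreal (gibbs f g h z) * indicator (fst -` A \<inter> space (M \<Otimes>\<^sub>M N)) z \<partial>(M \<Otimes>\<^sub>M N))"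
      by (simp add: emeasure_distr emeasure_density)
    also have "\<dots> = (\<integral>\<^sup>+ z. ennreal (gibbs f g h z) * indicator A (fst z) \<partial>(M \<Otimes>\<^sub>M N))"
      by (intro nn_integral_cong) (auto simp: indicator_def)
    also have "\<dots> = (\<integral>\<^sup>+ u. (\<integral>\<^sup>+ p. ennreal (gibbs f g h (u, p)) \<partial>N) * indicator A u \<partial>M)"
      by (subst M2.nn_integral_fst[symmetric]) (auto simp: nn_integral_multc intro!: nn_integral_cong)
    also have "\<dots> = (\<integral>\<^sup>+ u. indicator A u \<partial>M)"
      using marg unfolding fst_marginal_def by (intro nn_integral_cong_AE) auto
    finally show "emeasure (distr ?P M fst) A = emeasure M A" by simp
  qed simp
  have "integrable (distr ?P M fst) k" unfolding D by (rule k)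
  then have "integrable ?P (\<lambda>z. k (fst z))" by (subst (asm) integrable_distr_eq) auto
  then show "integrable (M \<Otimes>\<^sub>M N) (\<lambda>(u, p). k u * gibbs f g h (u, p))"
    by (subst (asm) integrable_density)
      (auto simp: gibbs_nonneg case_prod_unfold mult.commute)
  have "(LINT u|M. k u) = (LINT u|distr ?P M fst. k u)" unfolding D ..
  also have "\<dots> = (LINT z|?P. k (fst z))" by (rule integral_distr) auto
  also have "\<dots> = (LINT (u, p)|(M \<Otimes>\<^sub>M N). k u * gibbs f g h (u, p))"
    by (subst integral_density) (auto simp: gibbs_nonneg case_prod_unfold mult.commute)
  finally show "(LINT (u, p)|(M \<Otimes>\<^sub>M N). k u * gibbs f g h (u, p)) = (LINT u|M. k u)" ..
qed

lemma snd_marginal_integral: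
  fixes k :: "'b \<Rightarrow> real"
  assumes adm: "admissible f g h" and marg: "snd_marginal f g h" and k: "integrable N k"
  shows "integrable (M \<Otimes>\<^sub>M N) (\<lambda>(u, p). k p * gibbs f g h (u, p))"
    and "(LINT (u, p)|(M \<Otimes>\<^sub>M N). k p * gibbs f g h (u, p)) = (LINT p|N. k p)"
proof -
  let ?P = "density (M \<Otimes>\<^sub>M N) (\<lambda>z. ennreal (gibbs f g h z))"
  note [measurable] = gibbs_measurable[OF adm] borel_measurable_integrable[OF k]
  have D: "distr ?P N snd = N"
  proof (rule measure_eqI)
    fix A assume "A \<in> sets (distr ?P N snd)"
    then have A [measurable]: "A \<in> sets N" by simp
    have "emeasure (distr ?P N snd) A
        = (\<integral>\<^sup>+ z. ennreal (gibbs f g h z) * indicator (snd -` A \<inter> space (M \<Otimes>\<^sub>M N)) z \<partial>(M \<Otimes>\<^sub>M N))"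
      by (simp add: emeasure_distr emeasure_density)
    also have "\<dots> = (\<integral>\<^sup>+ z. ennreal (gibbs f g h z) * indicator A (snd z) \<partial>(M \<Otimes>\<^sub>M N))"
      by (intro nn_integral_cong) (auto simp: indicator_def)
    also have "\<dots> = (\<integral>\<^sup>+ p. (\<integral>\<^sup>+ u. ennreal (gibbs f g h (u, p)) \<partial>M) * indicator A p \<partial>N)"
      by (subst nn_integral_snd[symmetric]) (auto simp: nn_integral_multc intro!: nn_integral_cong)
    also have "\<dots> = (\<integral>\<^sup>+ p. indicator A p \<partial>N)"
      using marg unfolding snd_marginal_def by (intro nn_integral_cong_AE) auto
    finally show "emeasure (distr ?P N snd) A = emeasure N A" by simp
  qed simp
  have "integrable (distr ?P N snd) k" unfolding D by (rule k)
  then have "integrable ?P (\<lambda>z. k (snd z))" by (subst (asm) integrable_distr_eq) auto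
  then show "integrable (M \<Otimes>\<^sub>M N) (\<lambda>(u, p). k p * gibbs f g h (u, p))"
    by (subst (asm) integrable_density)
      (auto simp: gibbs_nonneg case_prod_unfold mult.commute)
  have "(LINT p|N. k p) = (LINT p|distr ?P N snd. k p)" unfolding D ..
  also have "\<dots> = (LINT z|?P. k (snd z))" by (rule integral_distr) auto
  also have "\<dots> = (LINT (u, p)|(M \<Otimes>\<^sub>M N). k p * gibbs f g h (u, p))"
    by (subst integral_density) (auto simp: gibbs_nonneg case_prod_unfold mult.commute)
  finally show "(LINT (u, p)|(M \<Otimes>\<^sub>M N). k p * gibbs f g h (u, p)) = (LINT p|N. k p)" ..
qed

lemma optimal_imp_fst_marginal:
  assumes adm: "admissible f g h" and opt: "optimal f g h"
  shows "fst_marginal f g h"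
proof -
  note [measurable] = gibbs_measurable[OF adm]
  have I: "integrable (M \<Otimes>\<^sub>M N) (gibbs f g h)" using opt by (simp add: optimal_def)
  have "density M (\<lambda>u. \<integral>\<^sup>+ p. ennreal (gibbs f g h (u, p)) \<partial>N) = density M (\<lambda>_. 1)"
  proof (rule measure_eqI)
    fix A assume "A \<in> sets (density M (\<lambda>u. \<integral>\<^sup>+ p. ennreal (gibbs f g h (u, p)) \<partial>N))"
    then have A [measurable]: "A \<in> sets M" by simp
    have IA: "integrable (M \<Otimes>\<^sub>M N) (\<lambda>z. indicator A (fst z) * gibbs f g h z :: real)"
      by (rule Bochner_Integration.integrable_bound[OF I])
        (auto simp: indicator_def gibbs_nonneg)
    have iA: "integrable M (\<lambda>u. indicator A u :: real)"
      by (rule M1.integrable_const_bound[where B = 1]) auto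
    have bound: "s * indicator A u \<le> \<bar>s\<bar>" for s :: real and u
      by (auto simp: indicator_def)
    have var: "(LINT u|M. s * indicator A u)
        \<le> (LINT z|(M \<Otimes>\<^sub>M N). s * (indicator A (fst z) * gibbs f g h z))" for s :: real
      using first_variation[OF adm opt, where \<phi> = "\<lambda>u. s * indicator A u" and \<gamma> = "\<lambda>_. 0"
          and \<eta> = "\<lambda>_. 0" and B = "\<bar>s\<bar>"] IA iA bound
      by (simp add: admissible_def case_prod_unfold mult.assoc)
    \<comment> \<open>The perturbations by the indicator of \<open>A\<close> and by its negative give the two inequalities.\<close>
    have eq: "measure M A = (LINT z|(M \<Otimes>\<^sub>M N). indicator A (fst z) * gibbs f g h z)"
      using var[of 1] var[of "-1"] by simp
    have "emeasure (density M (\<lambda>u. \<integral>\<^sup>+ p. ennreal (gibbs f g h (u, p)) \<partial>N)) A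
        = (\<integral>\<^sup>+ u. (\<integral>\<^sup>+ p. ennreal (indicator A u * gibbs f g h (u, p)) \<partial>N) \<partial>M)"
      by (subst emeasure_density) (auto intro!: nn_integral_cong simp: indicator_def)
    also have "\<dots> = (\<integral>\<^sup>+ z. ennreal (indicator A (fst z) * gibbs f g h z) \<partial>(M \<Otimes>\<^sub>M N))"
      by (subst M2.nn_integral_fst[symmetric]) auto
    also have "\<dots> = ennreal (measure M A)"
      unfolding eq by (intro nn_integral_eq_integral IA) (auto simp: gibbs_nonneg)
    also have "\<dots> = emeasure (density M (\<lambda>_. 1)) A"
      by (simp add: emeasure_density M1.emeasure_eq_measure)
    finally show "emeasure (density M (\<lambda>u. \<integral>\<^sup>+ p. ennreal (gibbs f g h (u, p)) \<partial>N)) A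
        = emeasure (density M (\<lambda>_. 1)) A" .
  qed simp
  then show ?thesis
    unfolding fst_marginal_def by (subst (asm) M1.density_unique_iff) auto
qed

lemma optimal_imp_snd_marginal:
  assumes adm: "admissible f g h" and opt: "optimal f g h"
  shows "snd_marginal f g h"
proof -
  note [measurable] = gibbs_measurable[OF adm]
  have I: "integrable (M \<Otimes>\<^sub>M N) (gibbs f g h)" using opt by (simp add: optimal_def)
  have "density N (\<lambda>p. \<integral>\<^sup>+ u. ennreal (gibbs f g h (u, p)) \<partial>M) = density N (\<lambda>_. 1)"
  proof (rule measure_eqI)
    fix A assume "A \<in> sets (density N (\<lambda>p. \<integral>\<^sup>+ u. ennreal (gibbs f g h (u, p)) \<partial>M))"
    then have A [measurable]: "A \<in> sets N" by simp
    have IA: "integrable (M \<Otimes>\<^sub>M N) (\<lambda>z. indicator A (snd z) * gibbs f g h z :: real)"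
      by (rule Bochner_Integration.integrable_bound[OF I])
        (auto simp: indicator_def gibbs_nonneg)
    have iA: "integrable N (\<lambda>p. indicator A p :: real)"
      by (rule M2.integrable_const_bound[where B = 1]) auto
    have bound: "s * indicator A p \<le> \<bar>s\<bar>" for s :: real and p
      by (auto simp: indicator_def)
    have var: "(LINT p|N. s * indicator A p)
        \<le> (LINT z|(M \<Otimes>\<^sub>M N). s * (indicator A (snd z) * gibbs f g h z))" for s :: real
      using first_variation[OF adm opt, where \<phi> = "\<lambda>_. 0" and \<gamma> = "\<lambda>_. 0"
          and \<eta> = "\<lambda>p. s * indicator A p" and B = "\<bar>s\<bar>"] IA iA bound
      by (simp add: admissible_def case_prod_unfold mult.assoc)
    have eq: "measure N A = (LINT z|(M \<Otimes>\<^sub>M N). indicator A (snd z) * gibbs f g h z)"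
      using var[of 1] var[of "-1"] by simp
    have "emeasure (density N (\<lambda>p. \<integral>\<^sup>+ u. ennreal (gibbs f g h (u, p)) \<partial>M)) A
        = (\<integral>\<^sup>+ p. (\<integral>\<^sup>+ u. ennreal (indicator A p * gibbs f g h (u, p)) \<partial>M) \<partial>N)"
      by (subst emeasure_density) (auto intro!: nn_integral_cong simp: indicator_def)
    also have "\<dots> = (\<integral>\<^sup>+ z. ennreal (indicator A (snd z) * gibbs f g h z) \<partial>(M \<Otimes>\<^sub>M N))"
      by (subst nn_integral_snd[symmetric]) auto
    also have "\<dots> = ennreal (measure N A)"
      unfolding eq by (intro nn_integral_eq_integral IA) (auto simp: gibbs_nonneg)
    also have "\<dots> = emeasure (density N (\<lambda>_. 1)) A"
      by (simp add: emeasure_density M2.emeasure_eq_measure)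
    finally show "emeasure (density N (\<lambda>p. \<integral>\<^sup>+ u. ennreal (gibbs f g h (u, p)) \<partial>M)) A
        = emeasure (density N (\<lambda>_. 1)) A" .
  qed simp
  then show ?thesis
    unfolding snd_marginal_def by (subst (asm) M2.density_unique_iff) auto
qed

text \<open>The fibre barycentre \<open>v\<close> exists because \<open>norm T\<close> is integrable under the second marginal. The
  variation in direction \<open>(0, - sgn v, - norm T)\<close> is nonpositive by the Cauchy-Schwarz inequality,
  and its first-order condition reads \<open>0 \<le> - \<integral> norm v\<close>.\<close>

lemma optimal_imp_fibre_barycentre_0:
  assumes adm: "admissible f g h" and opt: "optimal f g h"
  shows "fibre_barycentre_0 f g h"
proof -
  let ?E = "gibbs f g h"
  note [measurable] = gibbs_measurable[OF adm]
  note nT = snd_marginal_integral[OF adm optimal_imp_snd_marginal[OF adm opt]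
      integrable_norm[OF T_integrable]]
  have I: "integrable (M \<Otimes>\<^sub>M N) (\<lambda>z. ?E z *\<^sub>R T (snd z))"
    by (rule Bochner_Integration.integrable_bound[OF nT(1)])
      (auto simp: case_prod_unfold gibbs_nonneg)
  define v where "v u = (LINT p|N. ?E (u, p) *\<^sub>R T p)" for u
  have v: "integrable M v" unfolding v_def using integrable_fst'[OF I] by simp
  note [measurable] = borel_measurable_integrable[OF v]
  define \<gamma> where "\<gamma> u = - sgn (v u)" for u
  have \<gamma>m [measurable]: "\<gamma> \<in> borel_measurable M"
    unfolding \<gamma>_def sgn_div_norm by measurable
  have \<gamma>_le: "norm (\<gamma> u) \<le> 1" for u by (simp add: \<gamma>_def norm_sgn)
  have \<gamma>T: "\<bar>\<gamma> u \<bullet> T p\<bar> \<le> norm (T p)" for u p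
    using Cauchy_Schwarz_ineq2[of "\<gamma> u" "T p"] mult_right_mono[OF \<gamma>_le[of u], of "norm (T p)"]
    by simp
  have I\<gamma>: "integrable (M \<Otimes>\<^sub>M N) (\<lambda>z. (\<gamma> (fst z) \<bullet> T (snd z)) * ?E z)"
    by (rule Bochner_Integration.integrable_bound[OF nT(1)])
      (auto simp: case_prod_unfold gibbs_nonneg abs_mult intro!: mult_right_mono \<gamma>T)
  have "(LINT u|M. 0) + (LINT p|N. - norm (T p))
    \<le> (LINT (u, p)|(M \<Otimes>\<^sub>M N). (0 + \<gamma> u \<bullet> T p + - norm (T p)) * ?E (u, p))"
  proof (rule first_variation[OF adm opt, where B = 0])
    show "admissible (\<lambda>_. 0) \<gamma> (\<lambda>p. - norm (T p))"
      using T_integrable \<gamma>_le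
      by (auto simp: admissible_def intro!: M1.integrable_const_bound[where B = 1])
    show "0 + \<gamma> u \<bullet> T p + - norm (T p) \<le> 0" for u p using \<gamma>T[of u p] by simp
    show "integrable (M \<Otimes>\<^sub>M N) (\<lambda>(u, p). (0 + \<gamma> u \<bullet> T p + - norm (T p)) * ?E (u, p))"
      using Bochner_Integration.integrable_diff[OF I\<gamma> nT(1)]
      by (simp add: case_prod_unfold left_diff_distrib)
  qed
  also have "\<dots> = (LINT z|(M \<Otimes>\<^sub>M N). (\<gamma> (fst z) \<bullet> T (snd z)) * ?E z) - (LINT p|N. norm (T p))"
    using Bochner_Integration.integral_diff[OF I\<gamma> nT(1)] nT(2)
    by (simp add: case_prod_unfold left_diff_distrib)
  finally have "0 \<le> (LINT z|(M \<Otimes>\<^sub>M N). (\<gamma> (fst z) \<bullet> T (snd z)) * ?E z)" by simp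
  also have "\<dots> = (LINT u|M. LINT p|N. (\<gamma> u \<bullet> T p) * ?E (u, p))"
    using integral_fst'[OF I\<gamma>] by simp
  also have "\<dots> = (LINT u|M. - norm (v u))"
  proof (rule integral_cong_AE)
    show "(\<lambda>u. LINT p|N. (\<gamma> u \<bullet> T p) * ?E (u, p)) \<in> borel_measurable M" by measurable
    show "AE u in M. (LINT p|N. (\<gamma> u \<bullet> T p) * ?E (u, p)) = - norm (v u)"
      using AE_integrable_fst'[OF I]
    proof eventually_elim
      case (elim u)
      have "(LINT p|N. (\<gamma> u \<bullet> T p) * ?E (u, p)) = (LINT p|N. \<gamma> u \<bullet> (?E (u, p) *\<^sub>R T p))"
        by (simp add: mult.commute)
      also have "\<dots> = \<gamma> u \<bullet> v u"
        unfolding v_def using elim by (intro integral_inner_right) auto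
      also have "\<dots> = - norm (v u)"
        by (cases "v u = 0") (simp_all add: \<gamma>_def sgn_div_norm power2_norm_eq_inner[symmetric] power2_eq_square)
      finally show ?case .
    qed
  qed measurable
  finally have "(LINT u|M. norm (v u)) \<le> 0" by simp
  then have "(LINT u|M. norm (v u)) = 0" by (simp add: antisym)
  then have "AE u in M. v u = 0"
    using integral_nonneg_eq_0_iff_AE[of M "\<lambda>u. norm (v u)"] v by simp
  then show ?thesis
    using AE_integrable_fst'[OF I] unfolding fibre_barycentre_0_def v_def by eventually_elim simp
qed

text \<open>Sufficiency, from the tangent inequality for the exponential function.\<close>

lemma optimality_system_imp_optimal:
  assumes adm: "admissible f g h" and fst: "fst_marginal f g h"
    and bary: "fibre_barycentre_0 f g h" and snd: "snd_marginal f g h"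
  shows "optimal f g h"
  unfolding optimal_def
proof (intro conjI allI impI)
  let ?E = "gibbs f g h" and ?R = "M \<Otimes>\<^sub>M N"
  show I: "integrable ?R ?E"
    using fst_marginal_integral(1)[OF adm fst, of "\<lambda>_. 1"] by (simp add: case_prod_unfold)
  fix f' g' h' assume adm': "admissible f' g' h'" and I': "integrable ?R (gibbs f' g' h')"
  note [measurable] = gibbs_measurable[OF adm] admissible_measurable[OF adm]
    admissible_measurable[OF adm']
  define F where "F = (\<lambda>z. (f' (fst z) - f (fst z)) * ?E z)"
  define H where "H = (\<lambda>z. (h' (snd z) - h (snd z)) * ?E z)"
  define w where "w = (\<lambda>z. ((g' (fst z) - g (fst z)) \<bullet> T (snd z)) * ?E z)"
  have F: "integrable ?R F" "integral\<^sup>L ?R F = (LINT u|M. f' u) - (LINT u|M. f u)"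
    using fst_marginal_integral[OF adm fst, of "\<lambda>u. f' u - f u"] adm adm'
    by (simp_all add: F_def admissible_def case_prod_unfold)
  have H: "integrable ?R H" "integral\<^sup>L ?R H = (LINT p|N. h' p) - (LINT p|N. h p)"
    using snd_marginal_integral[OF adm snd, of "\<lambda>p. h' p - h p"] adm adm'
    by (simp_all add: H_def admissible_def case_prod_unfold)
  have convex: "F z + w z + H z \<le> \<epsilon> * (gibbs f' g' h' z - ?E z)" for z
  proof -
    obtain u p where z: "z = (u, p)" by (cases z)
    define s where "s = (f' u - f u) + (g' u - g u) \<bullet> T p + (h' p - h p)"
    have "gibbs f' g' h' z = ?E z * exp (s / \<epsilon>)"
      using gibbs_add[of f "\<lambda>u. f' u - f u" g "\<lambda>u. g' u - g u" h "\<lambda>p. h' p - h p" u p]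
      by (simp add: z s_def)
    moreover have "?E z * (s / \<epsilon>) \<le> ?E z * (exp (s / \<epsilon>) - 1)"
      by (intro mult_left_mono gibbs_nonneg) (use exp_ge_add_one_self[of "s / \<epsilon>"] in linarith)
    ultimately have "?E z * s \<le> \<epsilon> * (gibbs f' g' h' z - ?E z)"
      using eps_pos by (simp add: field_simps)
    then show ?thesis by (simp add: F_def H_def w_def s_def z algebra_simps)
  qed
  \<comment> \<open>Solving the tangent inequality for the mixed term \<open>w\<close> yields its integrable upper bound.\<close>
  have w: "integrable ?R w" "integral\<^sup>L ?R w = 0"
  proof -
    have m: "w \<in> borel_measurable ?R" unfolding w_def by measurable
    have G: "integrable ?R (\<lambda>z. \<epsilon> * (gibbs f' g' h' z - ?E z) - F z - H z)"
      using I I' F H by simp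
    have le: "w z \<le> \<epsilon> * (gibbs f' g' h' z - ?E z) - F z - H z" for z
      using convex[of z] by simp
    have fibre: "AE u in M. integrable N (\<lambda>p. w (u, p)) \<and> (LINT p|N. w (u, p)) = 0"
      using bary unfolding fibre_barycentre_0_def
    proof eventually_elim
      case (elim u)
      have "w (u, p) = (g' u - g u) \<bullet> (?E (u, p) *\<^sub>R T p)" for p
        by (simp add: w_def)
      with elim show ?case by (simp del: inner_scaleR_right)
    qed
    show "integrable ?R w" "integral\<^sup>L ?R w = 0"
      by (rule integrable_of_upper_bound_of_fibres[OF m G le fibre])+
  qed
  have "integral\<^sup>L ?R F + integral\<^sup>L ?R w + integral\<^sup>L ?R H = (LINT z|?R. F z + w z + H z)"
    using F w H by simp
  also have "\<dots> \<le> (LINT z|?R. \<epsilon> * (gibbs f' g' h' z - ?E z))"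
    using F w H I I' convex by (intro integral_mono) auto
  also have "\<dots> = \<epsilon> * (LINT z|?R. gibbs f' g' h' z) - \<epsilon> * (LINT z|?R. ?E z)"
    using I I' by (simp add: right_diff_distrib)
  finally show "finite_objective f' g' h' \<le> finite_objective f g h"
    using F(2) H(2) w(2) by (simp add: finite_objective_def)
qed

theorem optimal_iff:
  assumes "admissible f g h"
  shows "optimal f g h \<longleftrightarrow> fst_marginal f g h \<and> fibre_barycentre_0 f g h \<and> snd_marginal f g h"
  using assms optimality_system_imp_optimal optimal_imp_fst_marginal
    optimal_imp_fibre_barycentre_0 optimal_imp_snd_marginal by blast

text \<open>Since \<open>exp (f u / \<epsilon>)\<close> is constant on the fibre over \<open>u\<close>, and \<open>exp (h p / \<epsilon>)\<close> on the fibre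
  over \<open>p\<close>, the three conditions are the Schroedinger equations for the potentials.\<close>

lemma fst_marginal_iff:
  assumes adm: "admissible f g h"
  shows "fst_marginal f g h \<longleftrightarrow> (AE u in M. ereal (f u) = - ereal \<epsilon> * ln_ext (\<integral>\<^sup>+ p.
      ennreal (exp (1 / \<epsilon> * (g u \<bullet> T p + h p - c u p))) \<partial>N))"
  unfolding fst_marginal_def
proof (intro AE_cong)
  note [measurable] = admissible_measurable[OF adm]
  fix u assume [measurable]: "u \<in> space M"
  have [measurable]: "c u \<in> borel_measurable N"
    using measurable_compose[OF measurable_Pair1'[OF \<open>u \<in> space M\<close>] c_measurable] by simp
  have "(\<integral>\<^sup>+ p. ennreal (gibbs f g h (u, p)) \<partial>N)
      = (\<integral>\<^sup>+ p. ennreal (exp (f u / \<epsilon>)) * ennreal (exp (1 / \<epsilon> * (g u \<bullet> T p + h p - c u p))) \<partial>N)"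
    by (intro nn_integral_cong)
      (simp add: gibbs_def add_divide_distrib diff_divide_distrib flip: ennreal_mult exp_add)
  also have "\<dots> = ennreal (exp (f u / \<epsilon>))
      * (\<integral>\<^sup>+ p. ennreal (exp (1 / \<epsilon> * (g u \<bullet> T p + h p - c u p))) \<partial>N)"
    by (rule nn_integral_cmult) measurable
  finally show "((\<integral>\<^sup>+ p. ennreal (gibbs f g h (u, p)) \<partial>N) = 1)
      = (ereal (f u) = - ereal \<epsilon> * ln_ext (\<integral>\<^sup>+ p.
          ennreal (exp (1 / \<epsilon> * (g u \<bullet> T p + h p - c u p))) \<partial>N))"
    by (simp only: potential_eq_iff[OF eps_pos])
qed

lemma snd_marginal_iff:
  assumes adm: "admissible f g h"
  shows "snd_marginal f g h \<longleftrightarrow> (AE p in N. ereal (h p) = - ereal \<epsilon> * ln_ext (\<integral>\<^sup>+ u.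
      ennreal (exp (1 / \<epsilon> * (f u + g u \<bullet> T p - c u p))) \<partial>M))"
  unfolding snd_marginal_def
proof (intro AE_cong)
  note [measurable] = admissible_measurable[OF adm]
  fix p assume [measurable]: "p \<in> space N"
  have [measurable]: "(\<lambda>u. c u p) \<in> borel_measurable M"
    using measurable_compose[OF measurable_Pair2'[OF \<open>p \<in> space N\<close>] c_measurable] by simp
  have "(\<integral>\<^sup>+ u. ennreal (gibbs f g h (u, p)) \<partial>M)
      = (\<integral>\<^sup>+ u. ennreal (exp (h p / \<epsilon>)) * ennreal (exp (1 / \<epsilon> * (f u + g u \<bullet> T p - c u p))) \<partial>M)"
    by (intro nn_integral_cong)
      (simp add: gibbs_def add_divide_distrib diff_divide_distrib flip: ennreal_mult exp_add)
  also have "\<dots> = ennreal (exp (h p / \<epsilon>))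
      * (\<integral>\<^sup>+ u. ennreal (exp (1 / \<epsilon> * (f u + g u \<bullet> T p - c u p))) \<partial>M)"
    by (rule nn_integral_cmult) measurable
  finally show "((\<integral>\<^sup>+ u. ennreal (gibbs f g h (u, p)) \<partial>M) = 1)
      = (ereal (h p) = - ereal \<epsilon> * ln_ext (\<integral>\<^sup>+ u.
          ennreal (exp (1 / \<epsilon> * (f u + g u \<bullet> T p - c u p))) \<partial>M))"
    by (simp only: potential_eq_iff[OF eps_pos])
qed

lemma fibre_barycentre_0_iff:
  "fibre_barycentre_0 f g h \<longleftrightarrow> (AE u in M.
      integrable N (\<lambda>p. exp (1 / \<epsilon> * (g u \<bullet> T p + h p - c u p)) *\<^sub>R T p) \<and>
      (LINT p|N. exp (1 / \<epsilon> * (g u \<bullet> T p + h p - c u p)) *\<^sub>R T p) = 0)"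
  unfolding fibre_barycentre_0_def
proof (intro AE_cong)
  fix u
  let ?F = "\<lambda>p. exp (1 / \<epsilon> * (g u \<bullet> T p + h p - c u p)) *\<^sub>R T p"
  have eq: "gibbs f g h (u, p) *\<^sub>R T p = exp (f u / \<epsilon>) *\<^sub>R ?F p" for p
    by (simp add: gibbs_def add_divide_distrib diff_divide_distrib flip: exp_add)
  have "integrable N (\<lambda>p. exp (f u / \<epsilon>) *\<^sub>R ?F p) \<longleftrightarrow> integrable N ?F"
  proof
    assume "integrable N (\<lambda>p. exp (f u / \<epsilon>) *\<^sub>R ?F p)"
    then have "integrable N (\<lambda>p. inverse (exp (f u / \<epsilon>)) *\<^sub>R (exp (f u / \<epsilon>) *\<^sub>R ?F p))"
      by (rule integrable_scaleR_right)
    then show "integrable N ?F"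
      by (subst (asm) scaleR_scaleR) (simp only: left_inverse exp_not_eq_zero not_False_eq_True scaleR_one)
  qed (rule integrable_scaleR_right)
  then show "(integrable N (\<lambda>p. gibbs f g h (u, p) *\<^sub>R T p) \<and>
        (LINT p|N. gibbs f g h (u, p) *\<^sub>R T p) = 0)
      = (integrable N (\<lambda>p. exp (1 / \<epsilon> * (g u \<bullet> T p + h p - c u p)) *\<^sub>R T p) \<and>
        (LINT p|N. exp (1 / \<epsilon> * (g u \<bullet> T p + h p - c u p)) *\<^sub>R T p) = 0)"
    unfolding eq by (simp del: scaleR_scaleR)
qed

end

section \<open>The quadratic cost\<close>

theorem corollary2p1:
  fixes \<Omega> :: "'w measure"
    and X :: "'w \<Rightarrow> real ^ 'm"
    and Y :: "'w \<Rightarrow> real ^ 'n"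
    and \<nu> :: "((real ^ 'm) \<times> (real ^ 'n)) measure"
    and \<mu> :: "(real ^ 'n) measure"
    and \<epsilon> :: real
    and f :: "real ^ 'n \<Rightarrow> real"
    and g :: "real ^ 'n \<Rightarrow> real ^ 'm"
    and h :: "(real ^ 'm) \<times> (real ^ 'n) \<Rightarrow> real"
  assumes "prob_space \<Omega>"
    and "X \<in> borel_measurable \<Omega>" and "Y \<in> borel_measurable \<Omega>"
    and "\<nu> = distr \<Omega> borel (\<lambda>\<omega>. (X \<omega>, Y \<omega>))"
    and "integrable \<Omega> (\<lambda>\<omega>. (norm (X \<omega>))\<^sup>2 + (norm (Y \<omega>))\<^sup>2)"
    and "prob_space.expectation \<Omega> X = 0"
    and "prob_space \<mu>" and "sets \<mu> = sets borel"
    and "integrable \<mu> (\<lambda>u. (norm u)\<^sup>2)"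
    and "\<epsilon> > 0"
    and "invertible (prob_space.expectation \<Omega> (\<lambda>\<omega>. \<chi> i j. X \<omega> $ i * X \<omega> $ j) :: real ^ 'm ^ 'm)"
    and "\<And>a :: real. a > 0 \<Longrightarrow>
           compactin W1tilde_topology {Q \<in> P1tilde. KL Q (ref_tilde \<epsilon> \<mu> \<nu>) \<le> ereal a}"
    and "integrable \<mu> f" and "integrable \<mu> g" and "integrable \<nu> h"
  shows "dual_obj \<epsilon> \<mu> \<nu> f g h = dual_value \<epsilon> \<mu> \<nu> \<longleftrightarrow>
    (AE u in \<mu>. ereal (f u) = - ereal \<epsilon> * ln_ext (\<integral>\<^sup>+ (x, y).
        ennreal (exp (1 / \<epsilon> * (g u \<bullet> x + h (x, y) - cost u y))) \<partial>\<nu>)) \<and>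
    (AE u in \<mu>.
        integrable \<nu> (\<lambda>(x, y). exp (1 / \<epsilon> * (g u \<bullet> x + h (x, y) - cost u y)) *\<^sub>R x) \<and>
        (LINT (x, y)|\<nu>. exp (1 / \<epsilon> * (g u \<bullet> x + h (x, y) - cost u y)) *\<^sub>R x) = 0) \<and>
    (AE (x, y) in \<nu>. ereal (h (x, y)) = - ereal \<epsilon> * ln_ext (\<integral>\<^sup>+ u.
        ennreal (exp (1 / \<epsilon> * (f u + g u \<bullet> x - cost u y))) \<partial>\<mu>))"
proof -
  interpret \<Omega>: prob_space \<Omega> by fact
  interpret \<mu>: prob_space \<mu> by fact
  note [measurable] = \<open>X \<in> borel_measurable \<Omega>\<close> \<open>Y \<in> borel_measurable \<Omega>\<close>
  have XY [measurable]: "(\<lambda>\<omega>. (X \<omega>, Y \<omega>)) \<in> borel_measurable \<Omega>" by measurable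
  interpret \<nu>: prob_space \<nu> unfolding \<open>\<nu> = _\<close> using XY by (rule \<Omega>.prob_space_distr)
  have sets_\<nu>: "sets \<nu> = sets borel" by (simp add: \<open>\<nu> = _\<close>)
  have "integrable \<Omega> X"
  proof (rule Bochner_Integration.integrable_bound)
    show "integrable \<Omega> (\<lambda>\<omega>. ((norm (X \<omega>))\<^sup>2 + (norm (Y \<omega>))\<^sup>2) + 1)"
      using \<open>integrable \<Omega> (\<lambda>\<omega>. (norm (X \<omega>))\<^sup>2 + (norm (Y \<omega>))\<^sup>2)\<close> by simp
    have "t \<le> t\<^sup>2 + r\<^sup>2 + 1" for t r :: real
    proof -
      have "t\<^sup>2 - t + 1 / 4 \<ge> 0"
        using zero_le_power2[of "t - 1 / 2"] by (simp add: power2_eq_square algebra_simps)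
      then show ?thesis using zero_le_power2[of r] by linarith
    qed
    then show "AE \<omega> in \<Omega>. norm (X \<omega>) \<le> norm (((norm (X \<omega>))\<^sup>2 + (norm (Y \<omega>))\<^sup>2) + 1)"
      by simp
  qed simp
  moreover have "(fst :: (real ^ 'm) \<times> (real ^ 'n) \<Rightarrow> _) \<in> borel_measurable borel"
    by (intro borel_measurable_continuous_onI continuous_on_fst continuous_on_id)
  ultimately have T: "integrable \<nu> fst"
    unfolding \<open>\<nu> = _\<close> by (subst integrable_distr_eq[OF XY]) simp_all
  have sets_R: "sets (\<mu> \<Otimes>\<^sub>M \<nu>) = sets borel"
    using sets_pair_measure_cong[OF \<open>sets \<mu> = sets borel\<close> sets_\<nu>] by (simp only: borel_prod)
  define C where "C = (\<lambda>(u :: real ^ 'n) (p :: (real ^ 'm) \<times> (real ^ 'n)). cost u (snd p))"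
  have "case_prod C \<in> borel_measurable borel"
    unfolding C_def cost_def case_prod_unfold
    by (intro borel_measurable_continuous_onI continuous_on_mult continuous_on_power
        continuous_on_norm continuous_on_diff continuous_on_const continuous_on_fst
        continuous_on_snd continuous_on_id)
  then have Cm: "case_prod C \<in> borel_measurable (\<mu> \<Otimes>\<^sub>M \<nu>)"
    using measurable_cong_sets[OF sets_R refl] by blast
  interpret D: entropic_dual \<mu> \<nu> fst C \<epsilon>
    by unfold_locales (use T Cm \<open>\<epsilon> > 0\<close> in \<open>auto simp: C_def cost_def\<close>)
  have adm: "D.admissible f g h" unfolding D.admissible_def by (intro conjI) fact+
  have obj: "dual_obj \<epsilon> \<mu> \<nu> = D.objective"
    unfolding dual_obj_def D.objective_def D.gibbs_def ref_measure_def fun_eq_iff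
    by (simp add: C_def case_prod_unfold)
  have val: "dual_value \<epsilon> \<mu> \<nu>
      = (SUP (f, g, h) \<in> {(f, g, h). D.admissible f g h}. D.objective f g h)"
    by (simp add: dual_value_def obj D.admissible_def)
  show ?thesis
    unfolding obj val D.objective_eq_SUP_iff[OF adm] D.optimal_iff[OF adm]
      D.fst_marginal_iff[OF adm] D.snd_marginal_iff[OF adm] D.fibre_barycentre_0_iff
    by (simp add: C_def case_prod_unfold)
qed

end
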